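(* Let $\alpha=(\alpha_n)_{n\in\mathbb{N}}$ be a non-negative increasing sequence with $\lim_{n\to\infty}\alpha_n=\infty$, assume that $\alpha$ is stable, and let $\theta\in\Lambda_\infty(\alpha)$. The convolution operator $\widehat{T}_\theta:\Lambda_\infty(\alpha)\to\Lambda_\infty(\alpha)$ is power bounded if and only if $\sup_{k\in\mathbb{N}}\|\theta^{*k}\|_p<\infty$ for every $p\in\mathbb{N}$.
   Context: $\mathbb{N}=\{1,2,\dots\}$, $\mathbb{N}_0=\mathbb{N}\cup\{0\}$. The sequence $\alpha$ is stable if $\sup_{n\in\mathbb{N}}\alpha_{2n}/\alpha_n<\infty$. The power series space of infinite type is $\Lambda_\infty(\alpha)=\{x=(x_n)_{n\in\mathbb{N}}:\|x\|_k:=\sum_{n=1}^\infty|x_n|e^{k\alpha_n}<\infty\text{ for all }k\in\mathbb{N}\}$, a Fréchet space with the increasing sequence of seminorms $(\|\cdot\|_k)_{k\in\mathbb{N}}$; $(e_n)_{n\in\mathbb{N}}$ is its canonical basis. Symbols are indexed from $0$: $\theta=(\theta_n)_{n\in\mathbb{N}_0}$ is regarded as the element of $\Lambda_\infty(\alpha)$ whose $n$-th coordinate ($n\in\mathbb{N}$) is $\theta_{n-1}$, so $\|\theta\|_k=\sum_{n=1}^\infty|\theta_{n-1}|e^{k\alpha_n}$. The convolution operator $\widehat{T}_\theta$ is the continuous linear operator on $\Lambda_\infty(\alpha)$ with $\widehat{T}_\theta e_n=\sum_{j=n}^\infty\theta_{j-n}e_j$ and $\widehat{T}_\theta x=\sum_{n=1}^\infty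 x_n\widehat{T}_\theta e_n$ (it is well-defined and continuous for every $\theta\in\Lambda_\infty(\alpha)$ when $\alpha$ is stable). Convolution of sequences indexed by $\mathbb{N}_0$: $(\theta*\phi)_m=\sum_{i=0}^m\theta_i\phi_{m-i}$; $\theta^{*k}=\theta*\cdots*\theta$ ($k$ factors). A continuous linear operator $T$ on a Fréchet space $E$ with increasing seminorms $(\|\cdot\|_p)_{p\in\mathbb{N}}$ is power bounded if for every $p\in\mathbb{N}$ there exist $q\in\mathbb{N}$ and $C_p\ge1$ with $\|T^kx\|_p\le C_p\|x\|_q$ for all $k\in\mathbb{N}$, $x\in E$. *)

theory Defs
  imports "HOL-Analysis.Analysis"
begin

text \<open>
  The scalars range over a type of sort \<open>{real_normed_field, banach}\<close>, which covers both
  the real and the complex numbers.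

  A sequence indexed by \<open>{1, 2, ...}\<close> is a function on \<open>nat\<close> whose value at \<open>0\<close> is irrelevant
  (for \<open>\<alpha>\<close>) or fixed to be \<open>0\<close> (for elements of the power series space).
\<close>

section \<open>Sequence spaces with a family of seminorms\<close>

text \<open>A space \<open>E\<close> of scalar sequences with seminorms \<open>N p\<close>, where \<open>p\<close> ranges over \<open>{1, 2, ...}\<close>.\<close>

definition seminorm_topology ::
  "(nat \<Rightarrow> 'a::real_normed_field) set \<Rightarrow> (nat \<Rightarrow> (nat \<Rightarrow> 'a) \<Rightarrow> real) \<Rightarrow> (nat \<Rightarrow> 'a) topology"
  where "seminorm_topology E N =
    topology_generated_by
      {{y \<in> E. N p (\<lambda>i. y i - x i) < \<epsilon>} | x p \<epsilon>. x \<in> E \<and> 1 \<le> p \<and> 0 < \<epsilon>}"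

definition linear_operator_on ::
  "(nat \<Rightarrow> 'a::real_normed_field) set \<Rightarrow> ((nat \<Rightarrow> 'a) \<Rightarrow> (nat \<Rightarrow> 'a)) \<Rightarrow> bool"
  where "linear_operator_on E T \<longleftrightarrow>
    T ` E \<subseteq> E \<and>
    (\<forall>x\<in>E. \<forall>y\<in>E. T (\<lambda>i. x i + y i) = (\<lambda>i. T x i + T y i)) \<and>
    (\<forall>c. \<forall>x\<in>E. T (\<lambda>i. c * x i) = (\<lambda>i. c * T x i))"

definition continuous_linear_operator ::
  "(nat \<Rightarrow> 'a::real_normed_field) set \<Rightarrow> (nat \<Rightarrow> (nat \<Rightarrow> 'a) \<Rightarrow> real) \<Rightarrow>
    ((nat \<Rightarrow> 'a) \<Rightarrow> (nat \<Rightarrow> 'a)) \<Rightarrow> bool"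
  where "continuous_linear_operator E N T \<longleftrightarrow>
    linear_operator_on E T \<and>
    continuous_map (seminorm_topology E N) (seminorm_topology E N) T"

definition power_bounded ::
  "(nat \<Rightarrow> 'a::real_normed_field) set \<Rightarrow> (nat \<Rightarrow> (nat \<Rightarrow> 'a) \<Rightarrow> real) \<Rightarrow>
    ((nat \<Rightarrow> 'a) \<Rightarrow> (nat \<Rightarrow> 'a)) \<Rightarrow> bool"
  where "power_bounded E N T \<longleftrightarrow>
    continuous_linear_operator E N T \<and>
    (\<forall>p\<ge>1. \<exists>q\<ge>1. \<exists>C\<ge>1. \<forall>k\<ge>1. \<forall>x\<in>E. N p ((T ^^ k) x) \<le> C * N q x)"


section \<open>Power series spaces of infinite type\<close>

text \<open>
  Since \<open>x / 0 = 0\<close>, indices with \<open>\<alpha> n = 0\<close> impose no condition here. For \<open>\<alpha>\<close> tending to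
  infinity there are only finitely many of them, and sequences such as \<open>\<alpha> n = ln n\<close> are
  stable, as is customary.
\<close>

definition stable_seq :: "(nat \<Rightarrow> real) \<Rightarrow> bool"
  where "stable_seq \<alpha> \<longleftrightarrow> bdd_above ((\<lambda>n. \<alpha> (2 * n) / \<alpha> n) ` {1..})"

definition ps_term :: "(nat \<Rightarrow> real) \<Rightarrow> nat \<Rightarrow> (nat \<Rightarrow> 'a::real_normed_field) \<Rightarrow> nat \<Rightarrow> real"
  where "ps_term \<alpha> k x n = norm (x n) * exp (real k * \<alpha> n)"

definition ps_norm :: "(nat \<Rightarrow> real) \<Rightarrow> nat \<Rightarrow> (nat \<Rightarrow> 'a::real_normed_field) \<Rightarrow> real"
  where "ps_norm \<alpha> k x = (\<Sum>n. ps_term \<alpha> k x (Suc n))"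

definition ps_space :: "(nat \<Rightarrow> real) \<Rightarrow> (nat \<Rightarrow> 'a::real_normed_field) set"
  where "ps_space \<alpha> = {x. x 0 = 0 \<and> (\<forall>k\<ge>1. summable (\<lambda>n. ps_term \<alpha> k x (Suc n)))}"

definition unit_seq :: "nat \<Rightarrow> nat \<Rightarrow> 'a::real_normed_field"
  where "unit_seq n = (\<lambda>j. if j = n then 1 else 0)"

text \<open>The identification of a symbol, indexed from \<open>0\<close>, with a sequence indexed from \<open>1\<close>.\<close>

definition symbol_seq :: "(nat \<Rightarrow> 'a::real_normed_field) \<Rightarrow> nat \<Rightarrow> 'a"
  where "symbol_seq \<theta> = (\<lambda>n. case n of 0 \<Rightarrow> 0 | Suc m \<Rightarrow> \<theta> m)"


section \<open>Convolution\<close>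

definition seq_conv :: "(nat \<Rightarrow> 'a::real_normed_field) \<Rightarrow> (nat \<Rightarrow> 'a) \<Rightarrow> nat \<Rightarrow> 'a"
  where "seq_conv \<theta> \<phi> = (\<lambda>m. \<Sum>i\<le>m. \<theta> i * \<phi> (m - i))"

primrec conv_power :: "(nat \<Rightarrow> 'a::real_normed_field) \<Rightarrow> nat \<Rightarrow> nat \<Rightarrow> 'a"
  where
    "conv_power \<theta> 0 = unit_seq 0"
  | "conv_power \<theta> (Suc k) = seq_conv \<theta> (conv_power \<theta> k)"

text \<open>
  The image of the \<open>n\<close>-th basis vector is the series over \<open>j \<ge> n\<close> of \<open>\<theta> (j - n)\<close> times the
  \<open>j\<close>-th basis vector, i.e. the following sequence. Both this series and the series defining the
  operator are evaluated coordinatewise; that they converge in the topology of the power series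
  space is \<open>conv_image_series\<close> and \<open>conv_operator_series\<close> below.
\<close>

definition conv_image :: "(nat \<Rightarrow> 'a::real_normed_field) \<Rightarrow> nat \<Rightarrow> nat \<Rightarrow> 'a"
  where "conv_image \<theta> n = (\<lambda>j. if n \<le> j then \<theta> (j - n) else 0)"

definition conv_operator :: "(nat \<Rightarrow> 'a::real_normed_field) \<Rightarrow> (nat \<Rightarrow> 'a) \<Rightarrow> nat \<Rightarrow> 'a"
  where "conv_operator \<theta> x = (\<lambda>j. \<Sum>n. x (Suc n) * conv_image \<theta> (Suc n) j)"


section \<open>The convolution operator is well defined\<close>

lemma conv_power_1: "conv_power \<theta> 1 = \<theta>"
proof
  fix m
  have "conv_power \<theta> 1 m = (\<Sum>i\<le>m. if i = m then \<theta> m else 0)"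
    unfolding One_nat_def conv_power.simps seq_conv_def
    by (rule sum.cong) (auto simp: unit_seq_def)
  then show "conv_power \<theta> 1 m = \<theta> m" by simp
qed

lemma conv_operator_finite:
  "conv_operator \<theta> x j = (\<Sum>n<j. x (Suc n) * \<theta> (j - Suc n))"
proof -
  have "conv_operator \<theta> x j = (\<Sum>n<j. x (Suc n) * conv_image \<theta> (Suc n) j)"
    unfolding conv_operator_def by (rule suminf_finite) (auto simp: conv_image_def)
  also have "\<dots> = (\<Sum>n<j. x (Suc n) * \<theta> (j - Suc n))"
    by (rule sum.cong) (auto simp: conv_image_def)
  finally show ?thesis .
qed

lemma ps_term_nonneg [simp]: "0 \<le> ps_term \<alpha> k x n"
  by (simp add: ps_term_def)

lemma stable_seq_add:
  fixes \<alpha> :: "nat \<Rightarrow> real"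
  assumes nn: "\<And>n. 1 \<le> n \<Longrightarrow> 0 \<le> \<alpha> n" and mono: "mono_on {1..} \<alpha>"
    and lim: "filterlim \<alpha> at_top sequentially" and st: "stable_seq \<alpha>"
  obtains c :: nat and D :: real
  where "1 \<le> c" "\<And>m n. 1 \<le> m \<Longrightarrow> 1 \<le> n \<Longrightarrow> \<alpha> (m + n) \<le> real c * (\<alpha> m + \<alpha> n) + D"
proof -
  obtain M where M: "\<And>n. 1 \<le> n \<Longrightarrow> \<alpha> (2 * n) / \<alpha> n \<le> M"
    using st unfolding stable_seq_def bdd_above_def by auto
  obtain c :: nat where c: "max M 1 \<le> real c" using real_arch_simple by blast
  obtain N where N: "\<And>n. N \<le> n \<Longrightarrow> 0 < \<alpha> n"
    using filterlim_at_top_dense[THEN iffD1, OF lim, rule_format, of 0]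
    unfolding eventually_sequentially by blast
  let ?D = "\<alpha> (2 * Suc N)"
  have D: "0 \<le> ?D" by (rule nn) simp
  have dbl: "\<alpha> (2 * n) \<le> real c * \<alpha> n + ?D" if n: "1 \<le> n" for n
  proof (cases "\<alpha> n = 0")
    case True
    then have "n \<le> N" using N[of n] by (cases "N \<le> n") auto
    then have "\<alpha> (2 * n) \<le> ?D" using n by (intro mono_onD[OF mono]) auto
    then show ?thesis using True by simp
  next
    case False
    then have pos: "0 < \<alpha> n" using nn[OF n] by simp
    then have "\<alpha> (2 * n) \<le> M * \<alpha> n" using M[OF n] by (simp add: field_simps)
    also have "\<dots> \<le> real c * \<alpha> n" using c pos by (intro mult_right_mono) auto
    finally show ?thesis using D by simp
  qed
  show thesis
  proof (rule that[of c ?D])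
    show "1 \<le> c" using c by simp
    fix m n :: nat assume mn: "1 \<le> m" "1 \<le> n"
    have "\<alpha> (m + n) \<le> \<alpha> (2 * max m n)" using mn by (intro mono_onD[OF mono]) auto
    also have "\<dots> \<le> real c * \<alpha> (max m n) + ?D" using mn by (intro dbl) auto
    also have "\<dots> \<le> real c * (\<alpha> m + \<alpha> n) + ?D"
      using nn[OF mn(1)] nn[OF mn(2)] by (intro add_right_mono mult_left_mono) (auto simp: max_def)
    finally show "\<alpha> (m + n) \<le> real c * (\<alpha> m + \<alpha> n) + ?D" .
  qed
qed

lemma conv_operator_estimate:
  fixes \<alpha> :: "nat \<Rightarrow> real" and \<theta> :: "nat \<Rightarrow> 'a::{real_normed_field, banach}"
  assumes nn: "\<And>n. 1 \<le> n \<Longrightarrow> 0 \<le> \<alpha> n" and mono: "mono_on {1..} \<alpha>"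
    and lim: "filterlim \<alpha> at_top sequentially" and st: "stable_seq \<alpha>"
    and k: "1 \<le> k"
  obtains q :: nat and C :: real where "1 \<le> q" "0 < C"
    "\<forall>(\<theta> :: nat \<Rightarrow> 'a) x. symbol_seq \<theta> \<in> ps_space \<alpha> \<longrightarrow> x \<in> ps_space \<alpha> \<longrightarrow>
       summable (\<lambda>n. ps_term \<alpha> k (conv_operator \<theta> x) (Suc n)) \<and>
       ps_norm \<alpha> k (conv_operator \<theta> x) \<le> C * (ps_norm \<alpha> q x * ps_norm \<alpha> q (symbol_seq \<theta>))"
proof -
  obtain c D where c: "1 \<le> c"
    and add: "\<And>m n. 1 \<le> m \<Longrightarrow> 1 \<le> n \<Longrightarrow> \<alpha> (m + n) \<le> real c * (\<alpha> m + \<alpha> n) + D"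
    using stable_seq_add[OF nn mono lim st] by blast
  let ?q = "k * c" and ?C = "exp (real k * D)"
  show thesis
  proof (rule that[of ?q ?C])
    show "1 \<le> ?q" using c k by simp
    show "0 < ?C" by simp
  next
    have q: "1 \<le> ?q" using c k by simp
    show "\<forall>(\<theta> :: nat \<Rightarrow> 'a) x. symbol_seq \<theta> \<in> ps_space \<alpha> \<longrightarrow> x \<in> ps_space \<alpha> \<longrightarrow>
       summable (\<lambda>n. ps_term \<alpha> k (conv_operator \<theta> x) (Suc n)) \<and>
       ps_norm \<alpha> k (conv_operator \<theta> x) \<le> ?C * (ps_norm \<alpha> ?q x * ps_norm \<alpha> ?q (symbol_seq \<theta>))"
    proof (intro allI impI)
      fix \<theta> x :: "nat \<Rightarrow> 'a"
      assume th: "symbol_seq \<theta> \<in> ps_space \<alpha>" and x: "x \<in> ps_space \<alpha>"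
      define a where "a = (\<lambda>n. ps_term \<alpha> ?q x (Suc n))"
      define b where "b = (\<lambda>n. ps_term \<alpha> ?q (symbol_seq \<theta>) (Suc n))"
      have sa: "summable a" using x q unfolding ps_space_def a_def by blast
      have sb: "summable b" using th q unfolding ps_space_def b_def by blast
      have na: "summable (\<lambda>n. norm (a n))" using sa by (simp add: a_def)
      have nb: "summable (\<lambda>n. norm (b n))" using sb by (simp add: b_def)
      have ab: "(\<lambda>j. ?C * (\<Sum>i\<le>j. a i * b (j - i))) sums (?C * (suminf a * suminf b))"
        by (intro sums_mult Cauchy_product_sums na nb)
      have le: "ps_term \<alpha> k (conv_operator \<theta> x) (Suc j) \<le> ?C * (\<Sum>i\<le>j. a i * b (j - i))" for j
      proof -
        have "ps_term \<alpha> k (conv_operator \<theta> x) (Suc j) \<le>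
            (\<Sum>i\<le>j. norm (x (Suc i) * \<theta> (j - i))) * exp (real k * \<alpha> (Suc j))"
          unfolding ps_term_def conv_operator_finite lessThan_Suc_atMost
          by (intro mult_right_mono) (auto intro!: sum_norm_le)
        also have "\<dots> = (\<Sum>i\<le>j. norm (x (Suc i)) * norm (\<theta> (j - i)) * exp (real k * \<alpha> (Suc j)))"
          by (simp add: norm_mult sum_distrib_right)
        also have "\<dots> \<le> (\<Sum>i\<le>j. ?C * (a i * b (j - i)))"
        proof (rule sum_mono)
          fix i assume i: "i \<in> {..j}"
          have "\<alpha> (Suc j) \<le> \<alpha> (Suc i + Suc (j - i))"
            using i by (intro mono_onD[OF mono]) auto
          also have "\<dots> \<le> real c * (\<alpha> (Suc i) + \<alpha> (Suc (j - i))) + D" by (rule add) auto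
          finally have "real k * \<alpha> (Suc j) \<le> real k * (real c * (\<alpha> (Suc i) + \<alpha> (Suc (j - i))) + D)"
            by (intro mult_left_mono) auto
          also have "\<dots> = real k * D + real ?q * \<alpha> (Suc i) + real ?q * \<alpha> (Suc (j - i))"
            by (simp add: algebra_simps)
          finally have "exp (real k * \<alpha> (Suc j)) \<le>
              ?C * exp (real ?q * \<alpha> (Suc i)) * exp (real ?q * \<alpha> (Suc (j - i)))"
            by (simp flip: exp_add)
          then have "norm (x (Suc i)) * norm (\<theta> (j - i)) * exp (real k * \<alpha> (Suc j)) \<le>
              norm (x (Suc i)) * norm (\<theta> (j - i)) *
                (?C * exp (real ?q * \<alpha> (Suc i)) * exp (real ?q * \<alpha> (Suc (j - i))))"
            by (intro mult_left_mono) auto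
          then show "norm (x (Suc i)) * norm (\<theta> (j - i)) * exp (real k * \<alpha> (Suc j)) \<le>
              ?C * (a i * b (j - i))"
            by (simp add: a_def b_def ps_term_def symbol_seq_def mult_ac)
        qed
        finally show ?thesis by (simp add: sum_distrib_left)
      qed
      have s: "summable (\<lambda>n. ps_term \<alpha> k (conv_operator \<theta> x) (Suc n))"
        by (rule summable_comparison_test'[OF sums_summable[OF ab], of 0]) (use le in auto)
      moreover have "ps_norm \<alpha> k (conv_operator \<theta> x) \<le> ?C * (suminf a * suminf b)"
        unfolding ps_norm_def using suminf_le[OF le s sums_summable[OF ab]] sums_unique[OF ab] by simp
      ultimately show "summable (\<lambda>n. ps_term \<alpha> k (conv_operator \<theta> x) (Suc n)) \<and>
         ps_norm \<alpha> k (conv_operator \<theta> x) \<le> ?C * (ps_norm \<alpha> ?q x * ps_norm \<alpha> ?q (symbol_seq \<theta>))"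
        by (simp add: a_def b_def ps_norm_def)
    qed
  qed
qed

lemma ps_space_scale:
  assumes "x \<in> ps_space \<alpha>" shows "(\<lambda>i. c * x i) \<in> ps_space \<alpha>"
  using assms by (auto simp: ps_space_def ps_term_def norm_mult mult.assoc intro!: summable_mult)

lemma ps_term_add_le: "ps_term \<alpha> k (\<lambda>i. x i + y i) n \<le> ps_term \<alpha> k x n + ps_term \<alpha> k y n"
  unfolding ps_term_def by (simp flip: distrib_right add: norm_triangle_ineq)

lemma ps_space_add:
  assumes "x \<in> ps_space \<alpha>" "y \<in> ps_space \<alpha>" shows "(\<lambda>i. x i + y i) \<in> ps_space \<alpha>"
  unfolding ps_space_def
proof (intro CollectI conjI allI impI)
  show "x 0 + y 0 = 0" using assms by (simp add: ps_space_def)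
  fix k :: nat assume k: "1 \<le> k"
  show "summable (\<lambda>n. ps_term \<alpha> k (\<lambda>i. x i + y i) (Suc n))"
    by (rule summable_comparison_test'[where N = 0 and
          g = "\<lambda>n. ps_term \<alpha> k x (Suc n) + ps_term \<alpha> k y (Suc n)"])
      (use assms k in \<open>auto simp: ps_space_def ps_term_add_le intro!: summable_add\<close>)
qed

lemma ps_space_diff:
  assumes "x \<in> ps_space \<alpha>" "y \<in> ps_space \<alpha>" shows "(\<lambda>i. x i - y i) \<in> ps_space \<alpha>"
  using ps_space_add[OF assms(1) ps_space_scale[OF assms(2), of "-1"]] by simp

lemma ps_norm_add_le:
  assumes "x \<in> ps_space \<alpha>" "y \<in> ps_space \<alpha>" "1 \<le> k"
  shows "ps_norm \<alpha> k (\<lambda>i. x i + y i) \<le> ps_norm \<alpha> k x + ps_norm \<alpha> k y"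
proof -
  have s: "summable (\<lambda>n. ps_term \<alpha> k z (Suc n))" if "z \<in> ps_space \<alpha>" for z :: "nat \<Rightarrow> 'a"
    using that assms(3) by (simp add: ps_space_def)
  show ?thesis
    unfolding ps_norm_def suminf_add[OF s[OF assms(1)] s[OF assms(2)]]
    by (rule suminf_le) (auto simp: ps_term_add_le intro!: summable_add s assms ps_space_add)
qed

lemma ps_norm_nonneg: "x \<in> ps_space \<alpha> \<Longrightarrow> 1 \<le> k \<Longrightarrow> 0 \<le> ps_norm \<alpha> k x"
  unfolding ps_norm_def by (intro suminf_nonneg) (auto simp: ps_space_def)

lemma conv_operator_linear:
  "conv_operator \<theta> (\<lambda>i. x i + y i) = (\<lambda>i. conv_operator \<theta> x i + conv_operator \<theta> y i)"
  "conv_operator \<theta> (\<lambda>i. x i - y i) = (\<lambda>i. conv_operator \<theta> x i - conv_operator \<theta> y i)"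
  "conv_operator \<theta> (\<lambda>i. c * x i) = (\<lambda>i. c * conv_operator \<theta> x i)"
  by (auto simp: conv_operator_finite fun_eq_iff algebra_simps sum.distrib sum_subtractf
      sum_distrib_left)

lemma topspace_seminorm_topology:
  assumes "\<And>x. x \<in> E \<Longrightarrow> N 1 (\<lambda>i. x i - x i) = 0"
  shows "topspace (seminorm_topology E N) = E"
proof -
  have "x \<in> topspace (seminorm_topology E N)" if "x \<in> E" for x
    unfolding seminorm_topology_def topology_generated_by_topspace
    by (rule UnionI[of "{y \<in> E. N 1 (\<lambda>i. y i - x i) < 1}"])
      (use that assms[OF that] in \<open>auto intro!: exI[of _ "1::nat"] exI[of _ x] exI[of _ "1::real"]\<close>)
  then show ?thesis
    unfolding seminorm_topology_def topology_generated_by_topspace by auto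
qed

lemma ps_topspace: "topspace (seminorm_topology (ps_space \<alpha>) (ps_norm \<alpha>)) = ps_space \<alpha>"
  by (rule topspace_seminorm_topology) (simp add: ps_norm_def ps_term_def)

theorem conv_operator_continuous:
  fixes \<alpha> :: "nat \<Rightarrow> real" and \<theta> :: "nat \<Rightarrow> 'a::{real_normed_field, banach}"
  assumes nn: "\<And>n. 1 \<le> n \<Longrightarrow> 0 \<le> \<alpha> n" and mono: "mono_on {1..} \<alpha>"
    and lim: "filterlim \<alpha> at_top sequentially" and st: "stable_seq \<alpha>"
    and th: "symbol_seq \<theta> \<in> ps_space \<alpha>"
  shows "continuous_linear_operator (ps_space \<alpha>) (ps_norm \<alpha>) (conv_operator \<theta>)"
proof -
  let ?E = "ps_space \<alpha> :: (nat \<Rightarrow> 'a) set" and ?T = "conv_operator \<theta>"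
  let ?X = "seminorm_topology ?E (ps_norm \<alpha>)"
  have mem: "?T x \<in> ?E" if x: "x \<in> ?E" for x
    unfolding ps_space_def
  proof (intro CollectI conjI allI impI)
    show "?T x 0 = 0" by (simp add: conv_operator_finite)
    fix k :: nat assume "1 \<le> k"
    from conv_operator_estimate[where 'a = 'a, OF nn mono lim st this]
    show "summable (\<lambda>n. ps_term \<alpha> k (?T x) (Suc n))" using th x by metis
  qed
  have lin: "linear_operator_on ?E ?T"
    unfolding linear_operator_on_def using mem conv_operator_linear by auto
  have "continuous_map ?X ?X ?T"
  proof (subst (2) seminorm_topology_def, rule continuous_on_generated_topo)
    fix U assume "U \<in> {{y \<in> ?E. ps_norm \<alpha> p (\<lambda>i. y i - x i) < \<epsilon>} | x p \<epsilon>. x \<in> ?E \<and> 1 \<le> p \<and> 0 < \<epsilon>}"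
    then obtain z p \<epsilon> where U: "U = {y \<in> ?E. ps_norm \<alpha> p (\<lambda>i. y i - z i) < \<epsilon>}"
      and z: "z \<in> ?E" and p: "1 \<le> p" and e: "0 < \<epsilon>" by blast
    obtain q C where q: "1 \<le> q" and C: "0 < C" and est: "\<forall>(\<theta> :: nat \<Rightarrow> 'a) x. symbol_seq \<theta> \<in> ?E \<longrightarrow> x \<in> ?E \<longrightarrow>
       summable (\<lambda>n. ps_term \<alpha> p (conv_operator \<theta> x) (Suc n)) \<and>
       ps_norm \<alpha> p (conv_operator \<theta> x) \<le> C * (ps_norm \<alpha> q x * ps_norm \<alpha> q (symbol_seq \<theta>))"
      by (rule conv_operator_estimate[where 'a = 'a, OF nn mono lim st p])
    define B where "B = C * ps_norm \<alpha> q (symbol_seq \<theta>) + 1"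
    have B: "0 < B" unfolding B_def using C ps_norm_nonneg[OF th q] by (simp add: add_nonneg_pos)
    show "openin ?X (?T -` U \<inter> topspace ?X)"
    proof (subst openin_subopen, intro ballI)
      fix x assume x: "x \<in> ?T -` U \<inter> topspace ?X"
      then have xE: "x \<in> ?E" and xU: "ps_norm \<alpha> p (\<lambda>i. ?T x i - z i) < \<epsilon>"
        by (auto simp: ps_topspace U)
      define \<delta> where "\<delta> = (\<epsilon> - ps_norm \<alpha> p (\<lambda>i. ?T x i - z i)) / B"
      have d: "0 < \<delta>" using xU B by (simp add: \<delta>_def)
      let ?V = "{y \<in> ?E. ps_norm \<alpha> q (\<lambda>i. y i - x i) < \<delta>}"
      have "openin ?X ?V"
        unfolding seminorm_topology_def by (rule topology_generated_by_Basis) (use xE q d in blast)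
      moreover have "x \<in> ?V" using xE d by (simp add: ps_norm_def ps_term_def)
      moreover have "?V \<subseteq> ?T -` U \<inter> topspace ?X"
      proof
        fix y assume "y \<in> ?V"
        then have yE: "y \<in> ?E" and y: "ps_norm \<alpha> q (\<lambda>i. y i - x i) < \<delta>" by auto
        have yx: "(\<lambda>i. y i - x i) \<in> ?E" by (rule ps_space_diff[OF yE xE])
        have n0: "0 \<le> ps_norm \<alpha> q (\<lambda>i. y i - x i)" by (rule ps_norm_nonneg[OF yx q])
        have "ps_norm \<alpha> p (?T (\<lambda>i. y i - x i)) \<le> C * (ps_norm \<alpha> q (\<lambda>i. y i - x i) * ps_norm \<alpha> q (symbol_seq \<theta>))"
          using est th yx by blast
        also have "\<dots> \<le> B * ps_norm \<alpha> q (\<lambda>i. y i - x i)"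
          unfolding B_def using n0 by (simp add: algebra_simps)
        also have "\<dots> < B * \<delta>" using y B by simp
        also have "\<dots> = \<epsilon> - ps_norm \<alpha> p (\<lambda>i. ?T x i - z i)" using B by (simp add: \<delta>_def)
        finally have 1: "ps_norm \<alpha> p (?T (\<lambda>i. y i - x i)) < \<epsilon> - ps_norm \<alpha> p (\<lambda>i. ?T x i - z i)" .
        have "ps_norm \<alpha> p (\<lambda>i. ?T y i - z i) =
            ps_norm \<alpha> p (\<lambda>i. ?T (\<lambda>i. y i - x i) i + (?T x i - z i))"
          by (simp add: conv_operator_linear)
        also have "\<dots> \<le> ps_norm \<alpha> p (?T (\<lambda>i. y i - x i)) + ps_norm \<alpha> p (\<lambda>i. ?T x i - z i)"
          by (rule ps_norm_add_le[OF mem[OF yx] ps_space_diff[OF mem[OF xE] z] p])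
        finally show "y \<in> ?T -` U \<inter> topspace ?X"
          using 1 mem[OF yE] yE by (simp add: U ps_topspace)
      qed
      ultimately show "\<exists>V. openin ?X V \<and> x \<in> V \<and> V \<subseteq> ?T -` U \<inter> topspace ?X" by blast
    qed
  next
    show "?T ` topspace ?X \<subseteq>
        \<Union> {{y \<in> ?E. ps_norm \<alpha> p (\<lambda>i. y i - x i) < \<epsilon>} | x p \<epsilon>. x \<in> ?E \<and> 1 \<le> p \<and> 0 < \<epsilon>}"
      using mem ps_topspace[of \<alpha>, where 'a = 'a, symmetric,
          unfolded seminorm_topology_def topology_generated_by_topspace]
      by (subst ps_topspace) blast
  qed
  with lin show ?thesis unfolding continuous_linear_operator_def by blast
qed

lemma limitin_seminorm_topology:
  assumes y: "y \<in> topspace (seminorm_topology E N)"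
    and ev: "\<And>x p \<epsilon>. x \<in> E \<Longrightarrow> 1 \<le> p \<Longrightarrow> 0 < \<epsilon> \<Longrightarrow> N p (\<lambda>i. y i - x i) < \<epsilon> \<Longrightarrow>
      \<forall>\<^sub>F n in F. f n \<in> E \<and> N p (\<lambda>i. f n i - x i) < \<epsilon>"
  shows "limitin (seminorm_topology E N) f y F"
  unfolding limitin_def
proof (intro conjI y allI impI)
  fix U assume U: "openin (seminorm_topology E N) U \<and> y \<in> U"
  then have "generate_topology_on
      {{y \<in> E. N p (\<lambda>i. y i - x i) < \<epsilon>} | x p \<epsilon>. x \<in> E \<and> 1 \<le> p \<and> 0 < \<epsilon>} U"
    unfolding seminorm_topology_def openin_topology_generated_by_iff by blast
  moreover have "y \<in> U" using U by blast
  ultimately show "\<forall>\<^sub>F n in F. f n \<in> U"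
  proof induction
    case (Int a b)
    then show ?case by (auto intro: eventually_conj)
  next
    case (UN K)
    then obtain k where "k \<in> K" "y \<in> k" by blast
    then have "\<forall>\<^sub>F n in F. f n \<in> k" using UN by blast
    then show ?case by (rule eventually_mono) (use \<open>k \<in> K\<close> in blast)
  next
    case (Basis s)
    then show ?case using ev by auto
  qed simp
qed

lemma truncation_limit:
  fixes x :: "nat \<Rightarrow> 'a::real_normed_field"
  assumes x: "x \<in> ps_space \<alpha>"
  shows "limitin (seminorm_topology (ps_space \<alpha>) (ps_norm \<alpha>))
    (\<lambda>N j. \<Sum>n=1..N. x n * unit_seq n j) x sequentially"
proof (rule limitin_seminorm_topology)
  show "x \<in> topspace (seminorm_topology (ps_space \<alpha>) (ps_norm \<alpha>))" using x by (simp add: ps_topspace)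
next
  fix z p \<epsilon>
  assume z: "z \<in> ps_space \<alpha>" and p: "1 \<le> p" and e: "0 < \<epsilon>"
    and lt: "ps_norm \<alpha> p (\<lambda>i. x i - z i) < \<epsilon>"
  define t where "t = (\<lambda>N j. if 1 \<le> j \<and> j \<le> N then x j else 0)"
  have t: "(\<lambda>N j. \<Sum>n=1..N. x n * unit_seq n j) = t"
    by (auto simp: t_def unit_seq_def fun_eq_iff if_distrib[of "\<lambda>y. _ * y"] cong: if_cong)
  have tE: "t N \<in> ps_space \<alpha>" for N
    unfolding ps_space_def
    by (auto simp: t_def ps_term_def intro!: summable_finite[of "{..N}"] split: if_splits)
  have s: "summable (\<lambda>n. ps_term \<alpha> p x (Suc n))" using x p by (simp add: ps_space_def)
  have nt: "ps_norm \<alpha> p (\<lambda>i. t N i - x i) = (\<Sum>n. ps_term \<alpha> p x (Suc (n + N)))" for N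
  proof -
    have sd: "summable (\<lambda>n. ps_term \<alpha> p (\<lambda>i. t N i - x i) (Suc n))"
      using ps_space_diff[OF tE x] p unfolding ps_space_def by blast
    have "ps_norm \<alpha> p (\<lambda>i. t N i - x i) =
        (\<Sum>n. ps_term \<alpha> p (\<lambda>i. t N i - x i) (Suc (n + N))) +
        (\<Sum>n<N. ps_term \<alpha> p (\<lambda>i. t N i - x i) (Suc n))"
      unfolding ps_norm_def by (rule suminf_split_initial_segment[OF sd])
    also have "(\<Sum>n<N. ps_term \<alpha> p (\<lambda>i. t N i - x i) (Suc n)) = 0"
      by (rule sum.neutral) (auto simp: ps_term_def t_def)
    finally show ?thesis by (simp add: ps_term_def t_def)
  qed
  have "(\<lambda>N. \<Sum>n. ps_term \<alpha> p x (Suc (n + N))) \<longlonglongrightarrow> 0" by (rule suminf_exist_split2[OF s])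
  then have "\<forall>\<^sub>F N in sequentially.
      (\<Sum>n. ps_term \<alpha> p x (Suc (n + N))) < \<epsilon> - ps_norm \<alpha> p (\<lambda>i. x i - z i)"
    by (rule order_tendstoD) (use lt in simp)
  then show "\<forall>\<^sub>F N in sequentially. (\<lambda>j. \<Sum>n=1..N. x n * unit_seq n j) \<in> ps_space \<alpha> \<and>
      ps_norm \<alpha> p (\<lambda>i. (\<Sum>n=1..N. x n * unit_seq n i) - z i) < \<epsilon>"
  proof (rule eventually_mono)
    fix N assume N: "(\<Sum>n. ps_term \<alpha> p x (Suc (n + N))) < \<epsilon> - ps_norm \<alpha> p (\<lambda>i. x i - z i)"
    have "ps_norm \<alpha> p (\<lambda>i. t N i - z i) = ps_norm \<alpha> p (\<lambda>i. (t N i - x i) + (x i - z i))" by simp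
    also have "\<dots> \<le> ps_norm \<alpha> p (\<lambda>i. t N i - x i) + ps_norm \<alpha> p (\<lambda>i. x i - z i)"
      by (rule ps_norm_add_le[OF ps_space_diff[OF tE x] ps_space_diff[OF x z] p])
    finally have "ps_norm \<alpha> p (\<lambda>i. t N i - z i) < \<epsilon>" using N by (simp add: nt)
    then show "(\<lambda>j. \<Sum>n=1..N. x n * unit_seq n j) \<in> ps_space \<alpha> \<and>
      ps_norm \<alpha> p (\<lambda>i. (\<Sum>n=1..N. x n * unit_seq n i) - z i) < \<epsilon>"
      using tE[of N] by (simp only: fun_cong[OF t] fun_cong[OF fun_cong[OF t]])
  qed
qed

lemma unit_seq_in_space: "1 \<le> n \<Longrightarrow> unit_seq n \<in> ps_space \<alpha>"
  by (auto simp: ps_space_def ps_term_def unit_seq_def intro!: summable_finite[of "{..n}"] split: if_splits)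

theorem conv_operator_unit_seq:
  assumes "1 \<le> n" shows "conv_operator \<theta> (unit_seq n) = conv_image \<theta> n"
proof
  fix j
  obtain m where m: "n = Suc m" using assms by (cases n) auto
  have "(unit_seq n (Suc i) :: 'a) * \<theta> (j - Suc i) = (if i = m then \<theta> (j - n) else 0)" for i
    by (auto simp: unit_seq_def m)
  then have "conv_operator \<theta> (unit_seq n) j = (\<Sum>i<j. if i = m then \<theta> (j - n) else 0)"
    by (simp add: conv_operator_finite)
  then show "conv_operator \<theta> (unit_seq n) j = conv_image \<theta> n j"
    by (auto simp: conv_image_def m)
qed

theorem conv_image_series:
  fixes \<alpha> :: "nat \<Rightarrow> real" and \<theta> :: "nat \<Rightarrow> 'a::{real_normed_field, banach}"
  assumes "\<And>n. 1 \<le> n \<Longrightarrow> 0 \<le> \<alpha> n" and "mono_on {1..} \<alpha>"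
    and "filterlim \<alpha> at_top sequentially" and "stable_seq \<alpha>"
    and "symbol_seq \<theta> \<in> ps_space \<alpha>" and n: "1 \<le> n"
  shows "limitin (seminorm_topology (ps_space \<alpha>) (ps_norm \<alpha>))
    (\<lambda>N i. \<Sum>j=n..N. \<theta> (j - n) * unit_seq j i) (conv_image \<theta> n) sequentially"
proof -
  have "conv_image \<theta> n \<in> ps_space \<alpha>"
    using conv_operator_continuous[OF assms(1-5)] unit_seq_in_space[OF n]
      conv_operator_unit_seq[OF n, of \<theta>]
    unfolding continuous_linear_operator_def linear_operator_on_def by (metis image_subset_iff)
  then have "limitin (seminorm_topology (ps_space \<alpha>) (ps_norm \<alpha>))
    (\<lambda>N i. \<Sum>j=1..N. conv_image \<theta> n j * unit_seq j i) (conv_image \<theta> n) sequentially"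
    by (rule truncation_limit)
  moreover have "(\<Sum>j=1..N. conv_image \<theta> n j * unit_seq j i) =
      (\<Sum>j=n..N. \<theta> (j - n) * unit_seq j i)" for N i
    by (rule sum.mono_neutral_cong_right) (use n in \<open>auto simp: conv_image_def\<close>)
  ultimately show ?thesis by simp
qed

theorem conv_operator_series:
  fixes \<alpha> :: "nat \<Rightarrow> real" and \<theta> :: "nat \<Rightarrow> 'a::{real_normed_field, banach}"
  assumes "\<And>n. 1 \<le> n \<Longrightarrow> 0 \<le> \<alpha> n" and "mono_on {1..} \<alpha>"
    and "filterlim \<alpha> at_top sequentially" and "stable_seq \<alpha>"
    and "symbol_seq \<theta> \<in> ps_space \<alpha>" and x: "x \<in> ps_space \<alpha>"
  shows "limitin (seminorm_topology (ps_space \<alpha>) (ps_norm \<alpha>))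
    (\<lambda>N i. \<Sum>n=1..N. x n * conv_image \<theta> n i) (conv_operator \<theta> x) sequentially"
proof -
  have lim: "limitin (seminorm_topology (ps_space \<alpha>) (ps_norm \<alpha>))
    (conv_operator \<theta> \<circ> (\<lambda>N j. \<Sum>n=1..N. x n * unit_seq n j)) (conv_operator \<theta> x) sequentially"
    using conv_operator_continuous[OF assms(1-5)] truncation_limit[OF x]
    unfolding continuous_linear_operator_def by (blast intro: continuous_map_limit)
  have "conv_operator \<theta> (\<lambda>j. \<Sum>n=1..N. x n * unit_seq n j) = (\<lambda>i. \<Sum>n=1..N. x n * conv_image \<theta> n i)"
    for N
  proof (induction N)
    case 0
    show ?case by (simp add: conv_operator_finite fun_eq_iff)
  next
    case (Suc N)
    then show ?case
      by (simp add: conv_operator_linear conv_operator_unit_seq)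
  qed
  with lim show ?thesis by (simp add: o_def)
qed

lemma conv_operator_symbol_seq: "conv_operator \<theta> (symbol_seq \<phi>) = symbol_seq (seq_conv \<theta> \<phi>)"
proof
  fix j
  show "conv_operator \<theta> (symbol_seq \<phi>) j = symbol_seq (seq_conv \<theta> \<phi>) j"
  proof (cases j)
    case 0
    then show ?thesis by (simp add: conv_operator_finite symbol_seq_def)
  next
    case (Suc m)
    have "(\<Sum>n\<le>m. \<phi> n * \<theta> (m - n)) = (\<Sum>i\<le>m. \<theta> i * \<phi> (m - i))"
      by (rule sum.reindex_bij_witness[of _ "\<lambda>i. m - i" "\<lambda>i. m - i"]) auto
    then show ?thesis
      by (simp add: conv_operator_finite symbol_seq_def seq_conv_def Suc lessThan_Suc_atMost)
  qed
qed

theorem conv_power_in_space: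
  fixes \<alpha> :: "nat \<Rightarrow> real" and \<theta> :: "nat \<Rightarrow> 'a::{real_normed_field, banach}"
  assumes "\<And>n. 1 \<le> n \<Longrightarrow> 0 \<le> \<alpha> n" and "mono_on {1..} \<alpha>"
    and "filterlim \<alpha> at_top sequentially" and "stable_seq \<alpha>"
    and "symbol_seq \<theta> \<in> ps_space \<alpha>"
  shows "symbol_seq (conv_power \<theta> k) \<in> ps_space \<alpha>"
proof (induction k)
  case 0
  have "symbol_seq (unit_seq 0 :: nat \<Rightarrow> 'a) = unit_seq 1"
    by (auto simp: symbol_seq_def unit_seq_def fun_eq_iff split: nat.splits)
  then show ?case using unit_seq_in_space[of 1 \<alpha>] by simp
next
  case (Suc k)
  then have "conv_operator \<theta> (symbol_seq (conv_power \<theta> k)) \<in> ps_space \<alpha>"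
    using conv_operator_continuous[OF assms]
    unfolding continuous_linear_operator_def linear_operator_on_def by blast
  then show ?case by (simp add: conv_operator_symbol_seq)
qed

end

theory Submission
  imports Defs
begin

text \<open>
  The map \<open>\<theta> \<mapsto> conv_operator \<theta>\<close> turns convolution into composition, so the iterates of the
  operator are again convolution operators: the \<open>k\<close>-th one has symbol \<open>conv_power \<theta> k\<close>
  (\<open>conv_operator_funpow\<close>). Both directions are read off from this.

  If the operator is power bounded, the bound on its iterates is tested on the first basis vector,
  which is the unit of convolution: the \<open>k\<close>-th iterate maps it to \<open>conv_power \<theta> k\<close>.

  Conversely, stability of \<open>\<alpha>\<close> gives the estimate \<open>conv_operator_estimate\<close>, whose constants \<open>q\<close>
  and \<open>C\<close> are the same for all symbols. Applied to the symbol \<open>conv_power \<theta> k\<close>, it bounds the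
  \<open>k\<close>-th iterate by a \<open>q\<close>-seminorm of \<open>conv_power \<theta> k\<close>, and a bound on these that is uniform in
  \<open>k\<close> is power boundedness.
\<close>

text \<open>
  Sequences under convolution are formal power series under multiplication; associativity is
  inherited from there.
\<close>

lemma seq_conv_assoc: "seq_conv (seq_conv \<theta> \<phi>) \<psi> = seq_conv \<theta> (seq_conv \<phi> \<psi>)"
proof -
  have conv: "seq_conv f g = fps_nth (Abs_fps f * Abs_fps g)" for f g :: "nat \<Rightarrow> 'a"
    by (simp add: seq_conv_def fps_mult_nth fun_eq_iff atLeast0AtMost)
  show ?thesis
    by (simp add: conv fps_nth_inverse mult.assoc)
qed

lemma symbol_seq_shift: "x 0 = 0 \<Longrightarrow> symbol_seq (\<lambda>n. x (Suc n)) = x"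
  by (auto simp: symbol_seq_def fun_eq_iff split: nat.splits)

text \<open>
  Each application of the operator convolves the symbol of \<open>x\<close> once more with \<open>\<theta>\<close>, and
  associativity collects these factors. The hypothesis on \<open>x 0\<close> makes the case \<open>k = 0\<close> true: the
  zeroth iterate keeps that coordinate, whereas every convolution operator returns \<open>0\<close> there.
\<close>

lemma conv_operator_funpow:
  assumes "x 0 = 0"
  shows "(conv_operator \<theta> ^^ k) x = conv_operator (conv_power \<theta> k) x"
proof -
  define \<phi> where "\<phi> = (\<lambda>n. x (Suc n))"
  have x: "symbol_seq \<phi> = x"
    unfolding \<phi>_def using assms by (rule symbol_seq_shift)
  have unit: "seq_conv (unit_seq 0) \<phi> = \<phi>"
  proof
    fix m
    have "seq_conv (unit_seq 0) \<phi> m = (\<Sum>i\<le>m. if i = 0 then \<phi> m else 0)"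
      unfolding seq_conv_def by (rule sum.cong) (auto simp: unit_seq_def)
    then show "seq_conv (unit_seq 0) \<phi> m = \<phi> m" by simp
  qed
  have "(conv_operator \<theta> ^^ k) (symbol_seq \<phi>) = symbol_seq (seq_conv (conv_power \<theta> k) \<phi>)"
    by (induction k) (simp_all add: unit conv_operator_symbol_seq seq_conv_assoc)
  then show ?thesis
    by (simp add: x flip: conv_operator_symbol_seq)
qed

text \<open>The first basis vector is the unit of convolution, so it recovers the symbol.\<close>

lemma conv_operator_unit_1: "conv_operator \<theta> (unit_seq 1) = symbol_seq \<theta>"
  by (auto simp: conv_operator_unit_seq conv_image_def symbol_seq_def fun_eq_iff split: nat.splits)

theorem theorem4p5:
  fixes \<alpha> :: "nat \<Rightarrow> real"
    and \<theta> :: "nat \<Rightarrow> 'a::{real_normed_field, banach}"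
  assumes "\<And>n. 1 \<le> n \<Longrightarrow> 0 \<le> \<alpha> n"
    and "mono_on {1..} \<alpha>"
    and "filterlim \<alpha> at_top sequentially"
    and "stable_seq \<alpha>"
    and "symbol_seq \<theta> \<in> ps_space \<alpha>"
  shows "power_bounded (ps_space \<alpha>) (ps_norm \<alpha>) (conv_operator \<theta>) \<longleftrightarrow>
    (\<forall>p\<ge>1. bdd_above ((\<lambda>k. ps_norm \<alpha> p (symbol_seq (conv_power \<theta> k))) ` {1..}))"
proof
  assume pb: "power_bounded (ps_space \<alpha>) (ps_norm \<alpha>) (conv_operator \<theta>)"
  show "\<forall>p\<ge>1. bdd_above ((\<lambda>k. ps_norm \<alpha> p (symbol_seq (conv_power \<theta> k))) ` {1..})"
  proof (intro allI impI)
    fix p :: nat assume "1 \<le> p"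
    then obtain q C where bound: "\<And>k x. 1 \<le> k \<Longrightarrow> x \<in> ps_space \<alpha> \<Longrightarrow>
        ps_norm \<alpha> p ((conv_operator \<theta> ^^ k) x) \<le> C * ps_norm \<alpha> q x"
      using pb unfolding power_bounded_def by blast
    show "bdd_above ((\<lambda>k. ps_norm \<alpha> p (symbol_seq (conv_power \<theta> k))) ` {1..})"
    proof (rule bdd_aboveI2)
      fix k :: nat assume "k \<in> {1..}"
      then have "ps_norm \<alpha> p ((conv_operator \<theta> ^^ k) (unit_seq 1)) \<le>
          C * ps_norm \<alpha> q (unit_seq 1 :: nat \<Rightarrow> 'a)"
        by (intro bound unit_seq_in_space) auto
      moreover have "(conv_operator \<theta> ^^ k) (unit_seq 1) = symbol_seq (conv_power \<theta> k)"
        using conv_operator_funpow[of "unit_seq 1" k \<theta>] conv_operator_unit_1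
        by (simp add: unit_seq_def)
      ultimately show "ps_norm \<alpha> p (symbol_seq (conv_power \<theta> k)) \<le>
          C * ps_norm \<alpha> q (unit_seq 1 :: nat \<Rightarrow> 'a)"
        by simp
    qed
  qed
next
  assume bdd: "\<forall>p\<ge>1. bdd_above ((\<lambda>k. ps_norm \<alpha> p (symbol_seq (conv_power \<theta> k))) ` {1..})"
  have "\<exists>q\<ge>1. \<exists>C\<ge>1. \<forall>k\<ge>1. \<forall>x\<in>ps_space \<alpha>.
      ps_norm \<alpha> p ((conv_operator \<theta> ^^ k) x) \<le> C * ps_norm \<alpha> q x" if p: "1 \<le> p" for p
  proof -
    obtain q C where q: "1 \<le> q" and C: "0 < C"
      and est: "\<forall>(\<phi> :: nat \<Rightarrow> 'a) x. symbol_seq \<phi> \<in> ps_space \<alpha> \<longrightarrow> x \<in> ps_space \<alpha> \<longrightarrow>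
         summable (\<lambda>n. ps_term \<alpha> p (conv_operator \<phi> x) (Suc n)) \<and>
         ps_norm \<alpha> p (conv_operator \<phi> x) \<le> C * (ps_norm \<alpha> q x * ps_norm \<alpha> q (symbol_seq \<phi>))"
      using conv_operator_estimate[OF assms(1-4) p] by metis
    obtain M where M: "\<And>k. 1 \<le> k \<Longrightarrow> ps_norm \<alpha> q (symbol_seq (conv_power \<theta> k)) \<le> M"
      using bdd q unfolding bdd_above_def by (metis atLeast_iff image_eqI)
    have "ps_norm \<alpha> p ((conv_operator \<theta> ^^ k) x) \<le> max 1 (C * M) * ps_norm \<alpha> q x"
      if k: "1 \<le> k" and x: "x \<in> ps_space \<alpha>" for k and x :: "nat \<Rightarrow> 'a"
    proof -
      have nonneg: "0 \<le> ps_norm \<alpha> q x" by (rule ps_norm_nonneg[OF x q])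
      have "(conv_operator \<theta> ^^ k) x = conv_operator (conv_power \<theta> k) x"
        using x by (intro conv_operator_funpow) (simp add: ps_space_def)
      then have "ps_norm \<alpha> p ((conv_operator \<theta> ^^ k) x) \<le>
          C * (ps_norm \<alpha> q x * ps_norm \<alpha> q (symbol_seq (conv_power \<theta> k)))"
        using est conv_power_in_space[OF assms] x by simp
      also have "\<dots> \<le> C * (ps_norm \<alpha> q x * M)"
        using C nonneg M[OF k] by (intro mult_left_mono) auto
      also have "\<dots> = (C * M) * ps_norm \<alpha> q x" by simp
      also have "\<dots> \<le> max 1 (C * M) * ps_norm \<alpha> q x"
        using nonneg by (intro mult_right_mono) auto
      finally show ?thesis .
    qed
    then show ?thesis using q by (meson max.cobounded1)
  qed
  then show "power_bounded (ps_space \<alpha>) (ps_norm \<alpha>) (conv_operator \<theta>)"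
    unfolding power_bounded_def using conv_operator_continuous[OF assms] by blast
qed

end
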